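(* Let $D$ be a finite set, $M=\mathrm{QoI}(D)$ and $\sigma:\mathit{Var}\to M_1$. Then $\alpha_\sigma(\mathbb J_W)=\alpha^{\mathbb N}_\sigma(\mathbb J^{\mathbb N}_W)$ for every command $C$ and every $W\subseteq\mathit{Var}$ if and only if $\sigma(v)\otimes\sigma(v)=\sigma(v)$ for every $v\in\mathit{Var}$. Here $\mathbb J_W=\bigotimes_{w\in W}\Delta_C(w)$ and $\mathbb J^{\mathbb N}_W=\bigotimes_{w\in W}\Delta^{\mathbb N}_C(w)$. Moreover, the $\otimes$-idempotent elements of $\mathrm{QoI}(D)$ are exactly the principal ideals ${\downarrow}P$ ($P\in\mathrm{LoI}(D)$) together with $\bot=\emptyset$; so the condition says that every label $\sigma(v)$ is of the form ${\downarrow}P$ for an equivalence relation $P$ on $D$.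
   Context: Quantale of information. $D$ is finite. $\mathrm{LoI}(D)$ is the set of equivalence relations on $D$ ordered by $P\sqsubseteq Q$ iff $Q\subseteq P$, so $P\sqcup Q=P\cap Q$, the least element $\mathrm{All}$ is the total relation and the greatest, $\mathrm{Id}$, is equality. For $\mathbb P\subseteq\mathrm{LoI}(D)$, $\mathrm{mix}(\mathbb P)$ is the set of equivalence relations each of whose cells is a cell of some member of $\mathbb P$, and $\mathrm{tc}(\mathbb P)={\downarrow}\mathrm{mix}(\mathbb P)$. $\mathrm{QoI}(D)$ is the set of $\mathbb P$ with $\mathrm{tc}(\mathbb P)=\mathbb P$, ordered by inclusion (written $\sqsubseteq$), with $\bigvee_i\mathbb P_i=\mathrm{tc}(\bigcup_i\mathbb P_i)$, $\mathbb P\otimes\mathbb Q=\mathrm{tc}\{P\sqcup Q\mid P\in\mathbb P,Q\in\mathbb Q\}$, unit $1=\{\mathrm{All}\}$; it is a commutative complete quantale. For a quantale $M$, $M_1=\{m\mid 1\sqsubseteq m\}$, $m^0=1$, $m^n$ is the $n$-fold tensor power, $m^*=\bigvee_{n\ge0}m^n$; empty tensors are $1$. Language. $\mathit{Var}$ is finite. Commands: $\mathsf{skip}$, $x:=E$, $C_1;C_2$, $\mathsf{if}\;E\;C_1\;C_2$, $\mathsf{while}\;E\;C$; expressions include single variables; $\mathit{fv}(E)$ is the set of variables of $E$, $\mathit{asgn}(C)$ the set of variables assigned in $C$. Universal objects. $\mathcal U_{\mathbb N}$ is the set of downsets of $(\mathbb N^{\mathit{Var}},\le)$ ordered by inclusion,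 with $\bigvee=\bigcup$, $\mathbb M\otimes\mathbb N={\downarrow}\{m+n\mid m\in\mathbb M,n\in\mathbb N\}$, $1={\downarrow}0$, generators $\hat v={\downarrow}e_v$. $\mathcal U$ is the set of downsets of $(\mathcal P(\mathit{Var}),\subseteq)$ ordered by inclusion, with $\bigvee=\bigcup$, $\mathbb X\otimes\mathbb Y={\downarrow}\{X\cup Y\mid X\in\mathbb X,Y\in\mathbb Y\}$, $1={\downarrow}\emptyset$, generators $\hat v={\downarrow}\{v\}$. $\alpha^{\mathbb N}_\sigma(\mathbb M)=\bigvee_{m\in\mathbb M}\bigotimes_v\sigma(v)^{m(v)}$ and $\alpha_\sigma(\mathbb X)=\bigvee_{X\in\mathbb X}\bigotimes_{v\in X}\sigma(v)$. Algorithmic system. For a commutative complete quantale $M$, $t_E(\Gamma)=\bigotimes_{v\in\mathit{fv}(E)}\Gamma(v)$ and $\mathcal A^C_M(p,\Gamma):\mathit{Var}\to M_1$ ($p\in M_1$, $\Gamma:\mathit{Var}\to M_1$) is defined by recursion on $C$: $\Gamma$ for $\mathsf{skip}$; $\Gamma[x\mapsto p\otimes t_E(\Gamma)]$ for $x:=E$; $\mathcal A^{C_2}(p,\mathcal A^{C_1}(p,\Gamma))$ for $C_1;C_2$; for $\mathsf{if}\;E\;C_1\;C_2$, with $t=t_E(\Gamma)$, $\Gamma_i'=\mathcal A^{C_i}(p\otimes t,\Gamma)$, the environment $x\mapsto t\otimes(\Gamma_1'(x)\vee\Gamma_2'(x))$ for $x\in\mathit{asgn}(C_1)\cup\mathit{asgn}(C_2)$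 and $x\mapsto\Gamma(x)$ otherwise; for $\mathsf{while}\;E\;C$, with $\Gamma^*$ the least fixed point of $\Theta\mapsto\Gamma\vee\mathcal A^C(p\otimes t_E(\Theta),\Theta)$ and $t=t_E(\Gamma^* )$, the environment $x\mapsto t^*\otimes\Gamma^*(x)$ for $x\in\mathit{asgn}(C)$ and $x\mapsto\Gamma^*(x)$ otherwise. $\Delta_C=\mathcal A^C_{\mathcal U}(1,v\mapsto\hat v)$ and $\Delta^{\mathbb N}_C=\mathcal A^C_{\mathcal U_{\mathbb N}}(1,v\mapsto\hat v)$. *)

theory Defs
  imports Main
begin

section \<open>Commutative complete quantales\<close>

text \<open>
  The tensor is written multiplicatively, so the finite tensor products and the tensor powers
  are the library's \<open>\<Prod>\<close> and \<open>^\<close>; the empty tensor is \<open>1\<close>.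
  The information order \<open>\<sqsubseteq>\<close> is \<open>\<le>\<close>.
\<close>

class comm_quantale = complete_lattice + comm_monoid_mult +
  assumes mult_Sup: "x * Sup A = Sup ((*) x ` A)"
begin

definition star :: "'a \<Rightarrow> 'a" where
  "star m = (SUP n. m ^ n)"

lemma mult_sup: "x * sup a b = sup (x * a) (x * b)"
  using mult_Sup[of x "{a, b}"] by simp

lemma mult_left_mono': "a \<le> b \<Longrightarrow> x * a \<le> x * b"
  by (metis mult_sup le_iff_sup)

lemma mult_mono': "a \<le> b \<Longrightarrow> c \<le> d \<Longrightarrow> a * c \<le> b * d"
  by (metis mult_left_mono' mult.commute order.trans)

lemma one_le_mult: "1 \<le> a \<Longrightarrow> 1 \<le> b \<Longrightarrow> 1 \<le> a * b"
  using mult_mono'[of 1 a 1 b] by simp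

lemma power_mono': "a \<le> b \<Longrightarrow> a ^ n \<le> b ^ n"
  by (induction n) (auto intro: mult_mono')

lemma star_mono: "a \<le> b \<Longrightarrow> star a \<le> star b"
  unfolding star_def by (rule SUP_mono') (rule power_mono')

lemma one_le_star: "1 \<le> star a"
  unfolding star_def by (rule SUP_upper2[of 0]) simp_all

lemma prod_mono': "(\<And>v. v \<in> A \<Longrightarrow> f v \<le> g v) \<Longrightarrow> prod f A \<le> prod g A"
  by (induction A rule: infinite_finite_induct) (auto intro: mult_mono')

lemma one_le_prod: "(\<And>v. v \<in> A \<Longrightarrow> 1 \<le> f v) \<Longrightarrow> 1 \<le> prod f A"
  using prod_mono'[of A "\<lambda>_. 1" f] by simp

end


section \<open>Commands and the algorithmic system\<close>

text \<open>
  The expression language is a parameter \<open>'e\<close>; it enters only through its free-variable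
  function \<open>fv :: 'e \<Rightarrow> 'v set\<close>.
\<close>

datatype ('v, 'e) com =
    Skip
  | Assign 'v 'e
  | Seq "('v, 'e) com" "('v, 'e) com"
  | Cond 'e "('v, 'e) com" "('v, 'e) com"
  | While 'e "('v, 'e) com"

primrec asgn :: "('v, 'e) com \<Rightarrow> 'v set" where
  "asgn Skip = {}"
| "asgn (Assign x E) = {x}"
| "asgn (Seq C1 C2) = asgn C1 \<union> asgn C2"
| "asgn (Cond E C1 C2) = asgn C1 \<union> asgn C2"
| "asgn (While E C) = asgn C"

definition tE :: "('e \<Rightarrow> 'v set) \<Rightarrow> 'e \<Rightarrow> ('v \<Rightarrow> 'm::comm_quantale) \<Rightarrow> 'm" where
  "tE fv E \<Gamma> = (\<Prod>v\<in>fv E. \<Gamma> v)"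

text \<open>
  Environments \<open>'v \<Rightarrow> 'm\<close> form a complete lattice pointwise, and \<open>lfp\<close> is taken there. The
  system is meant for \<open>p\<close> and \<open>\<Gamma>\<close> above \<open>1\<close>; the function is stated on all of \<open>'m\<close>, which
  makes no difference: the lemmas \<open>alg_while_fixpoint\<close> and \<open>alg_while_least\<close> below show that the
  \<open>lfp\<close> is a fixed point lying above \<open>1\<close>, and the least one.
\<close>

primrec alg ::
  "('e \<Rightarrow> 'v set) \<Rightarrow> ('v, 'e) com \<Rightarrow> 'm \<Rightarrow> ('v \<Rightarrow> 'm) \<Rightarrow> ('v \<Rightarrow> 'm::comm_quantale)" where
  "alg fv Skip = (\<lambda>p \<Gamma>. \<Gamma>)"
| "alg fv (Assign x E) = (\<lambda>p \<Gamma>. \<Gamma>(x := p * tE fv E \<Gamma>))"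
| "alg fv (Seq C1 C2) = (\<lambda>p \<Gamma>. alg fv C2 p (alg fv C1 p \<Gamma>))"
| "alg fv (Cond E C1 C2) = (\<lambda>p \<Gamma>.
     let t = tE fv E \<Gamma>;
         \<Gamma>1 = alg fv C1 (p * t) \<Gamma>;
         \<Gamma>2 = alg fv C2 (p * t) \<Gamma>
     in (\<lambda>x. if x \<in> asgn C1 \<union> asgn C2 then t * sup (\<Gamma>1 x) (\<Gamma>2 x) else \<Gamma> x))"
| "alg fv (While E C) = (\<lambda>p \<Gamma>.
     let \<Gamma>' = lfp (\<lambda>\<Theta>. sup \<Gamma> (alg fv C (p * tE fv E \<Theta>) \<Theta>));
         t = tE fv E \<Gamma>'
     in (\<lambda>x. if x \<in> asgn C then star t * \<Gamma>' x else \<Gamma>' x))"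

lemma tE_mono: "\<Gamma> \<le> \<Gamma>' \<Longrightarrow> tE fv E \<Gamma> \<le> tE fv E \<Gamma>'"
  unfolding tE_def by (rule prod_mono') (simp add: le_fun_def)

lemma one_le_tE: "(\<And>v. 1 \<le> \<Gamma> v) \<Longrightarrow> 1 \<le> tE fv E \<Gamma>"
  unfolding tE_def by (rule one_le_prod)

lemma alg_mono: "p \<le> p' \<Longrightarrow> \<Gamma> \<le> \<Gamma>' \<Longrightarrow> alg fv C p \<Gamma> \<le> alg fv C p' \<Gamma>'"
proof (induction C arbitrary: p p' \<Gamma> \<Gamma>')
  case Skip
  then show ?case by simp
next
  case (Assign x E)
  then show ?case
    using mult_mono'[OF Assign.prems(1) tE_mono[OF Assign.prems(2), of fv E]]
    by (simp add: le_fun_def)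
next
  case (Seq C1 C2)
  then show ?case
    by (simp only: alg.simps)
next
  case (Cond E C1 C2)
  have t: "tE fv E \<Gamma> \<le> tE fv E \<Gamma>'"
    by (rule tE_mono[OF Cond.prems(2)])
  have pt: "p * tE fv E \<Gamma> \<le> p' * tE fv E \<Gamma>'"
    by (rule mult_mono'[OF Cond.prems(1) t])
  have 1: "alg fv C1 (p * tE fv E \<Gamma>) \<Gamma> x \<le> alg fv C1 (p' * tE fv E \<Gamma>') \<Gamma>' x" for x
    using Cond.IH(1)[OF pt Cond.prems(2)] by (simp add: le_fun_def)
  have 2: "alg fv C2 (p * tE fv E \<Gamma>) \<Gamma> x \<le> alg fv C2 (p' * tE fv E \<Gamma>') \<Gamma>' x" for x
    using Cond.IH(2)[OF pt Cond.prems(2)] by (simp add: le_fun_def)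
  have 3: "tE fv E \<Gamma> * sup (alg fv C1 (p * tE fv E \<Gamma>) \<Gamma> x) (alg fv C2 (p * tE fv E \<Gamma>) \<Gamma> x) \<le>
      tE fv E \<Gamma>' * sup (alg fv C1 (p' * tE fv E \<Gamma>') \<Gamma>' x) (alg fv C2 (p' * tE fv E \<Gamma>') \<Gamma>' x)" for x
    by (rule mult_mono'[OF t sup_mono[OF 1 2]])
  show ?case
    using 3 Cond.prems(2) by (simp add: Let_def le_fun_def)
next
  case (While E C)
  let ?F = "\<lambda>p \<Gamma> \<Theta>. sup \<Gamma> (alg fv C (p * tE fv E \<Theta>) \<Theta>)"
  have F: "?F p \<Gamma> \<Theta> \<le> ?F p' \<Gamma>' \<Theta>" for \<Theta>
    by (rule sup_mono[OF While.prems(2) While.IH[OF mult_mono'[OF While.prems(1) order.refl] order.refl]])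
  have L: "lfp (?F p \<Gamma>) \<le> lfp (?F p' \<Gamma>')"
    by (rule lfp_mono) (rule F)
  then have Lx: "lfp (?F p \<Gamma>) x \<le> lfp (?F p' \<Gamma>') x" for x
    by (simp add: le_fun_def)
  show ?case
    using Lx mult_mono'[OF star_mono[OF tE_mono[OF L, of fv E]] Lx] by (simp add: Let_def le_fun_def)
qed

lemma alg_while_mono:
  fixes \<Gamma> :: "'v \<Rightarrow> 'm::comm_quantale"
  shows "mono (\<lambda>\<Theta>. sup \<Gamma> (alg fv C (p * tE fv E \<Theta>) \<Theta>))"
proof (rule monoI)
  fix \<Theta> \<Theta>' :: "'v \<Rightarrow> 'm"
  assume le: "\<Theta> \<le> \<Theta>'"
  show "sup \<Gamma> (alg fv C (p * tE fv E \<Theta>) \<Theta>) \<le> sup \<Gamma> (alg fv C (p * tE fv E \<Theta>') \<Theta>')"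
    by (rule sup_mono[OF order.refl alg_mono[OF mult_left_mono'[OF tE_mono[OF le]] le]])
qed

lemma alg_while_fixpoint:
  fixes p \<Gamma> fv E C
  defines "F \<equiv> \<lambda>\<Theta>. sup \<Gamma> (alg fv C (p * tE fv E \<Theta>) \<Theta>)"
  shows "F (lfp F) = lfp F" and "(\<And>v. 1 \<le> \<Gamma> v) \<Longrightarrow> 1 \<le> lfp F v"
proof -
  show eq: "F (lfp F) = lfp F"
    unfolding F_def by (rule lfp_unfold[symmetric]) (rule alg_while_mono)
  have "\<Gamma> \<le> F (lfp F)"
    unfolding F_def by simp
  then have "\<Gamma> v \<le> lfp F v"
    using eq by (simp add: le_fun_def)
  then show "(\<And>v. 1 \<le> \<Gamma> v) \<Longrightarrow> 1 \<le> lfp F v"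
    using order.trans by blast
qed

lemma alg_while_least:
  fixes p \<Gamma> fv E C
  defines "F \<equiv> \<lambda>\<Theta>. sup \<Gamma> (alg fv C (p * tE fv E \<Theta>) \<Theta>)"
  assumes "F \<Theta> = \<Theta>"
  shows "lfp F \<le> \<Theta>"
  by (rule lfp_lowerbound) (simp add: assms(2))

lemma one_le_alg: "1 \<le> p \<Longrightarrow> (\<And>v. 1 \<le> \<Gamma> v) \<Longrightarrow> 1 \<le> alg fv C p \<Gamma> v"
proof (induction C arbitrary: p \<Gamma> v)
  case (Cond E C1 C2)
  have "1 \<le> alg fv C1 (p * tE fv E \<Gamma>) \<Gamma> v"
    by (intro Cond.IH(1) Cond.prems one_le_mult one_le_tE)
  then show ?case
    using one_le_mult[OF one_le_tE[of \<Gamma> fv E, OF Cond.prems(2)] le_supI1] Cond.prems(2)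
    by (simp add: Let_def)
next
  case (While E C)
  then show ?case
    using alg_while_fixpoint(2)[of \<Gamma> fv C p E]
    by (auto simp: Let_def intro!: one_le_mult one_le_star)
qed (auto intro!: one_le_mult one_le_tE)


section \<open>The quantale of information\<close>

definition LoI :: "('d \<times> 'd) set set" where
  "LoI = {P. equiv UNIV P}"

definition loi_le :: "('d \<times> 'd) set \<Rightarrow> ('d \<times> 'd) set \<Rightarrow> bool" where
  "loi_le P Q \<longleftrightarrow> Q \<subseteq> P"

definition loi_down :: "('d \<times> 'd) set set \<Rightarrow> ('d \<times> 'd) set set" where
  "loi_down \<P> = {Q \<in> LoI. \<exists>P\<in>\<P>. loi_le Q P}"

definition mix :: "('d \<times> 'd) set set \<Rightarrow> ('d \<times> 'd) set set" where
  "mix \<P> = {Q \<in> LoI. UNIV // Q \<subseteq> (\<Union>P\<in>\<P>. UNIV // P)}"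

definition tc :: "('d \<times> 'd) set set \<Rightarrow> ('d \<times> 'd) set set" where
  "tc \<P> = loi_down (mix \<P>)"

lemma tc_subset: "tc \<P> \<subseteq> LoI"
  by (auto simp: tc_def loi_down_def)

lemma tc_mono: "\<P> \<subseteq> \<Q> \<Longrightarrow> tc \<P> \<subseteq> tc \<Q>"
proof -
  assume "\<P> \<subseteq> \<Q>"
  then have "mix \<P> \<subseteq> mix \<Q>"
    unfolding mix_def using UN_mono[of \<P> \<Q>] by blast
  then show ?thesis
    unfolding tc_def loi_down_def by blast
qed

lemma tc_extensive: "\<P> \<subseteq> LoI \<Longrightarrow> \<P> \<subseteq> tc \<P>"
proof
  fix P assume "\<P> \<subseteq> LoI" "P \<in> \<P>"
  then have "P \<in> LoI" "P \<in> mix \<P>"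
    by (auto simp: mix_def)
  then show "P \<in> tc \<P>"
    by (auto simp: tc_def loi_down_def loi_le_def)
qed

lemma mix_iff:
  assumes "\<P> \<subseteq> LoI"
  shows "Q \<in> mix \<P> \<longleftrightarrow> Q \<in> LoI \<and> (\<forall>x. \<exists>P\<in>\<P>. Q `` {x} = P `` {x})"
proof -
  have "Q `` {x} = P `` {x}"
    if "Q \<in> LoI" "P \<in> LoI" "Q `` {x} \<in> UNIV // P" for P Q :: "('a \<times> 'a) set" and x
  proof -
    from that(3) obtain y where y: "Q `` {x} = P `` {y}"
      by (auto simp: quotient_def)
    have "x \<in> Q `` {x}"
      using that(1) by (auto simp: LoI_def equiv_def refl_on_def)
    with y have "(y, x) \<in> P" by auto
    with that(2) y show ?thesis
      by (simp add: LoI_def equiv_class_eq)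
  qed
  note eq = this
  show ?thesis
  proof
    assume Q: "Q \<in> mix \<P>"
    have "\<exists>P\<in>\<P>. Q `` {x} = P `` {x}" for x
    proof -
      have "Q `` {x} \<in> (\<Union>P\<in>\<P>. UNIV // P)"
        using Q quotientI[of x UNIV Q] by (auto simp: mix_def)
      then obtain P where P: "P \<in> \<P>" "Q `` {x} \<in> UNIV // P"
        by blast
      have "Q `` {x} = P `` {x}"
        by (rule eq[OF _ _ P(2)]) (use Q assms P(1) in \<open>auto simp: mix_def\<close>)
      with P(1) show ?thesis ..
    qed
    then show "Q \<in> LoI \<and> (\<forall>x. \<exists>P\<in>\<P>. Q `` {x} = P `` {x})"
      using Q by (simp add: mix_def)
  next
    assume Q: "Q \<in> LoI \<and> (\<forall>x. \<exists>P\<in>\<P>. Q `` {x} = P `` {x})"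
    have "c \<in> (\<Union>P\<in>\<P>. UNIV // P)" if c: "c \<in> UNIV // Q" for c
    proof -
      obtain x where x: "c = Q `` {x}"
        using c by (auto simp: quotient_def)
      obtain P where P: "P \<in> \<P>" "Q `` {x} = P `` {x}"
        using Q by blast
      have "c \<in> UNIV // P"
        unfolding x P(2) by (rule quotientI) simp
      with P(1) show ?thesis ..
    qed
    with Q show "Q \<in> mix \<P>"
      by (auto simp: mix_def)
  qed
qed

lemma tc_iff:
  assumes "\<P> \<subseteq> LoI"
  shows "Q \<in> tc \<P> \<longleftrightarrow>
    Q \<in> LoI \<and> (\<exists>R\<in>LoI. R \<subseteq> Q \<and> (\<forall>x. \<exists>P\<in>\<P>. R `` {x} = P `` {x}))"
  using mix_iff[OF assms] by (auto simp: tc_def loi_down_def loi_le_def)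

lemma tc_tc:
  assumes "\<P> \<subseteq> LoI"
  shows "tc (tc \<P>) = tc \<P>"
proof
  show "tc \<P> \<subseteq> tc (tc \<P>)"
    by (rule tc_extensive[OF tc_subset])
  show "tc (tc \<P>) \<subseteq> tc \<P>"
  proof
    fix Q assume "Q \<in> tc (tc \<P>)"
    then obtain R where Q: "Q \<in> LoI" and R: "R \<in> LoI" "R \<subseteq> Q"
      and ex: "\<And>x. \<exists>P\<in>tc \<P>. R `` {x} = P `` {x}"
      unfolding tc_iff[OF tc_subset] by blast
    have "\<forall>x. \<exists>S. S \<in> LoI \<and> (\<forall>y\<in>R `` {x}. S `` {y} \<subseteq> R `` {x}) \<and>
        (\<forall>y. \<exists>P\<in>\<P>. S `` {y} = P `` {y})"
    proof
      fix x
      obtain P where P: "P \<in> tc \<P>" "R `` {x} = P `` {x}"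
        using ex by blast
      obtain S where S: "S \<in> LoI" "S \<subseteq> P" "\<forall>y. \<exists>P\<in>\<P>. S `` {y} = P `` {y}"
        using P(1) tc_iff[OF assms, of P] by auto
      have PL: "equiv UNIV P"
        using P(1) tc_subset[of \<P>] by (auto simp: LoI_def)
      have "S `` {y} \<subseteq> R `` {x}" if "y \<in> R `` {x}" for y
      proof -
        have "(x, y) \<in> P" using that P(2) by auto
        then have "P `` {x} = P `` {y}"
          by (rule equiv_class_eq[OF PL])
        with S(2) P(2) show ?thesis by auto
      qed
      with S(1,3) show "\<exists>S. S \<in> LoI \<and> (\<forall>y\<in>R `` {x}. S `` {y} \<subseteq> R `` {x}) \<and>
          (\<forall>y. \<exists>P\<in>\<P>. S `` {y} = P `` {y})"
        by (intro exI[of _ S] conjI ballI) simp_all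
    qed
    from choice[OF this] obtain f where f0: "\<forall>x. f x \<in> LoI \<and>
        (\<forall>y\<in>R `` {x}. f x `` {y} \<subseteq> R `` {x}) \<and> (\<forall>y. \<exists>P\<in>\<P>. f x `` {y} = P `` {y})"
      by (rule exE)
    have f: "f x \<in> LoI"
      and fR: "y \<in> R `` {x} \<Longrightarrow> f x `` {y} \<subseteq> R `` {x}"
      and fP: "\<exists>P\<in>\<P>. f x `` {y} = P `` {y}" for x y
      using f0[rule_format, of x] by simp_all
    define g where "g x = f (SOME y. y \<in> R `` {x})" for x
    have eR: "equiv UNIV R"
      using R by (simp add: LoI_def)
    have eR: "equiv UNIV R"
      using R by (simp add: LoI_def)
    have Rxx: "(x, x) \<in> R" for x
      using eR by (simp add: equiv_def refl_on_def)
    have geq: "g x = g y" if "(x, y) \<in> R" for x y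
      unfolding g_def equiv_class_eq[OF eR that] ..
    have gR: "g x `` {x} \<subseteq> R `` {x}" for x
    proof -
      let ?z = "SOME z. z \<in> R `` {x}"
      have "(x, ?z) \<in> R"
        using someI[of "\<lambda>z. z \<in> R `` {x}" x] Rxx by simp
      then have "R `` {x} = R `` {?z}"
        by (rule equiv_class_eq[OF eR])
      with fR[of x ?z] Rxx[of x] show ?thesis
        unfolding g_def by blast
    qed
    have gP: "\<exists>P\<in>\<P>. g x `` {x} = P `` {x}" for x
      unfolding g_def by (rule fP)
    have ge: "equiv UNIV (g x)" for x
      using f[of "SOME y. y \<in> R `` {x}"] unfolding g_def LoI_def by simp
    define S where "S = {(a, b). (a, b) \<in> g a}"
    have SR: "S \<subseteq> R"
      using gR by (auto simp: S_def)
    have "equiv UNIV S"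
    proof (rule equivI)
      show "refl S"
        using ge by (auto simp: S_def refl_on_def equiv_def)
      show "sym S"
      proof (rule symI)
        fix a b assume ab: "(a, b) \<in> S"
        then have "g a = g b" using SR geq by blast
        with ab ge[of a] show "(b, a) \<in> S"
          by (auto simp: S_def equiv_def sym_def)
      qed
      show "trans S"
      proof (rule transI)
        fix a b c assume ab: "(a, b) \<in> S" and bc: "(b, c) \<in> S"
        then have "g a = g b" using SR geq by blast
        with ab bc ge[of a] show "(a, c) \<in> S"
          by (auto simp: S_def equiv_def dest: transD)
      qed
    qed simp
    moreover have "S `` {x} = g x `` {x}" for x
      by (auto simp: S_def)
    ultimately have "S \<in> LoI" "\<forall>x. \<exists>P\<in>\<P>. S `` {x} = P `` {x}"
      using gP by (auto simp: LoI_def)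
    with SR R(2) Q show "Q \<in> tc \<P>"
      unfolding tc_iff[OF assms] by blast
  qed
qed

lemma tc_LoI: "tc LoI = LoI"
  using tc_subset tc_extensive by blast

typedef 'd qoi = "{\<P>::('d \<times> 'd) set set. \<P> \<subseteq> LoI \<and> tc \<P> = \<P>}"
  using tc_LoI by blast

lemma Rep_qoi_subset: "Rep_qoi m \<subseteq> LoI" and tc_Rep_qoi: "tc (Rep_qoi m) = Rep_qoi m"
  using Rep_qoi[of m] by auto

lemma Rep_Abs_tc: "\<P> \<subseteq> LoI \<Longrightarrow> Rep_qoi (Abs_qoi (tc \<P>)) = tc \<P>"
  by (rule Abs_qoi_inverse) (simp add: tc_subset tc_tc)

text \<open>The tensor of sets of partitions before closing: \<open>P \<squnion> Q\<close> in \<open>LoI\<close> is \<open>P \<inter> Q\<close>.\<close>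

definition joins :: "('d \<times> 'd) set set \<Rightarrow> ('d \<times> 'd) set set \<Rightarrow> ('d \<times> 'd) set set" where
  "joins \<P> \<Q> = {P \<inter> Q | P Q. P \<in> \<P> \<and> Q \<in> \<Q>}"

lemma LoI_Int: "P \<in> LoI \<Longrightarrow> Q \<in> LoI \<Longrightarrow> P \<inter> Q \<in> LoI"
  unfolding LoI_def equiv_def by (auto intro: refl_on_Int[of UNIV P UNIV Q, simplified] sym_Int trans_Int)

lemma joins_subset: "\<P> \<subseteq> LoI \<Longrightarrow> \<Q> \<subseteq> LoI \<Longrightarrow> joins \<P> \<Q> \<subseteq> LoI"
  by (auto simp: joins_def intro: LoI_Int)

lemma joins_tc:
  assumes P: "\<P> \<subseteq> LoI" and Q: "\<Q> \<subseteq> LoI"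
  shows "joins \<P> (tc \<Q>) \<subseteq> tc (joins \<P> \<Q>)"
proof
  fix Z assume "Z \<in> joins \<P> (tc \<Q>)"
  then obtain A B where Z: "Z = A \<inter> B" and A: "A \<in> \<P>" and B: "B \<in> tc \<Q>"
    by (auto simp: joins_def)
  from B obtain R where BL: "B \<in> LoI" and R: "R \<in> LoI" "R \<subseteq> B"
    "\<forall>x. \<exists>P\<in>\<Q>. R `` {x} = P `` {x}"
    unfolding tc_iff[OF Q] by blast
  have "\<exists>P\<in>joins \<P> \<Q>. (A \<inter> R) `` {x} = P `` {x}" for x
  proof -
    obtain P where "P \<in> \<Q>" "R `` {x} = P `` {x}" using R(3) by blast
    then have "A \<inter> P \<in> joins \<P> \<Q>" "(A \<inter> R) `` {x} = (A \<inter> P) `` {x}"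
      using A by (auto simp: joins_def)
    then show ?thesis by blast
  qed
  moreover have "A \<in> LoI"
    using A P by (rule subsetD[rotated])
  then have "A \<inter> R \<in> LoI" "A \<inter> B \<in> LoI"
    using BL R(1) by (simp_all add: LoI_Int)
  moreover have "A \<inter> R \<subseteq> A \<inter> B"
    using R(2) by (rule Int_mono[OF order.refl])
  ultimately show "Z \<in> tc (joins \<P> \<Q>)"
    unfolding tc_iff[OF joins_subset[OF P Q]] Z by (intro conjI bexI[of _ "A \<inter> R"]) simp_all
qed

lemma tc_eqI: "\<P> \<subseteq> LoI \<Longrightarrow> \<Q> \<subseteq> LoI \<Longrightarrow> \<P> \<subseteq> tc \<Q> \<Longrightarrow> \<Q> \<subseteq> tc \<P> \<Longrightarrow> tc \<P> = tc \<Q>"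
  using tc_mono[of \<P> "tc \<Q>"] tc_mono[of \<Q> "tc \<P>"] tc_tc[of \<P>] tc_tc[of \<Q>] by simp

lemma tc_joins_tc:
  assumes "\<P> \<subseteq> LoI" "\<Q> \<subseteq> LoI"
  shows "tc (joins \<P> (tc \<Q>)) = tc (joins \<P> \<Q>)"
proof (rule tc_eqI)
  show "joins \<P> (tc \<Q>) \<subseteq> LoI" "joins \<P> \<Q> \<subseteq> LoI"
    by (intro joins_subset assms tc_subset)+
  show "joins \<P> (tc \<Q>) \<subseteq> tc (joins \<P> \<Q>)"
    using assms by (rule joins_tc)
  have "joins \<P> \<Q> \<subseteq> joins \<P> (tc \<Q>)"
    using tc_extensive[OF assms(2)] by (auto simp: joins_def)
  then show "joins \<P> \<Q> \<subseteq> tc (joins \<P> (tc \<Q>))"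
    using tc_extensive[OF \<open>joins \<P> (tc \<Q>) \<subseteq> LoI\<close>] by blast
qed

lemma joins_commute: "joins \<P> \<Q> = joins \<Q> \<P>"
  by (auto simp: joins_def)

lemma joinsI: "a \<in> A \<Longrightarrow> b \<in> B \<Longrightarrow> a \<inter> b \<in> joins A B"
  unfolding joins_def by blast

lemma joinsE:
  assumes "x \<in> joins A B"
  obtains a b where "a \<in> A" "b \<in> B" "x = a \<inter> b"
  using assms unfolding joins_def by blast

lemma joins_assoc: "joins (joins A B) C = joins A (joins B C)"
proof (intro set_eqI iffI)
  fix x assume "x \<in> joins (joins A B) C"
  then obtain a b c where "a \<in> A" "b \<in> B" "c \<in> C" and x: "x = (a \<inter> b) \<inter> c"
    by (elim joinsE) simp
  then have "a \<inter> (b \<inter> c) \<in> joins A (joins B C)"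
    using joinsI[OF _ joinsI[of b B c C], of a A] by simp
  then show "x \<in> joins A (joins B C)"
    by (simp only: x Int_assoc)
next
  fix x assume "x \<in> joins A (joins B C)"
  then obtain a b c where "a \<in> A" "b \<in> B" "c \<in> C" and x: "x = a \<inter> (b \<inter> c)"
    by (elim joinsE) simp
  then have "(a \<inter> b) \<inter> c \<in> joins (joins A B) C"
    using joinsI[OF joinsI[of a A b B], of c C] by simp
  then show "x \<in> joins (joins A B) C"
    by (simp only: x Int_assoc)
qed

lemma tc_Union_tc:
  assumes "\<And>\<P>. \<P> \<in> X \<Longrightarrow> \<P> \<subseteq> LoI"
  shows "tc (\<Union>(tc ` X)) = tc (\<Union>X)"
proof (rule tc_eqI)
  show "\<Union>X \<subseteq> LoI"
    by (rule Union_least) (rule assms)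
  show L: "\<Union>(tc ` X) \<subseteq> LoI"
    by (rule UN_least) (rule tc_subset)
  show "\<Union>(tc ` X) \<subseteq> tc (\<Union>X)"
    by (rule UN_least) (rule tc_mono[OF Union_upper])
  have "\<P> \<subseteq> tc (\<Union>(tc ` X))" if "\<P> \<in> X" for \<P>
    using tc_extensive[OF assms[OF that]] UN_upper[OF that, of tc] tc_extensive[OF L]
    by (rule order.trans[OF order.trans])
  then show "\<Union>X \<subseteq> tc (\<Union>(tc ` X))"
    by (rule Union_least)
qed

instantiation qoi :: (type) comm_quantale
begin

definition less_eq_qoi :: "'a qoi \<Rightarrow> 'a qoi \<Rightarrow> bool" where
  "m \<le> n \<longleftrightarrow> Rep_qoi m \<subseteq> Rep_qoi n"

definition less_qoi :: "'a qoi \<Rightarrow> 'a qoi \<Rightarrow> bool" where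
  "m < n \<longleftrightarrow> Rep_qoi m \<subset> Rep_qoi n"

definition Sup_qoi :: "'a qoi set \<Rightarrow> 'a qoi" where
  "Sup X = Abs_qoi (tc (\<Union>m\<in>X. Rep_qoi m))"

definition Inf_qoi :: "'a qoi set \<Rightarrow> 'a qoi" where
  "Inf X = Abs_qoi (LoI \<inter> (\<Inter>m\<in>X. Rep_qoi m))"

definition sup_qoi :: "'a qoi \<Rightarrow> 'a qoi \<Rightarrow> 'a qoi" where
  "sup m n = Abs_qoi (tc (Rep_qoi m \<union> Rep_qoi n))"

definition inf_qoi :: "'a qoi \<Rightarrow> 'a qoi \<Rightarrow> 'a qoi" where
  "inf m n = Abs_qoi (LoI \<inter> (Rep_qoi m \<inter> Rep_qoi n))"

definition bot_qoi :: "'a qoi" where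
  "bot = Abs_qoi (tc {})"

definition top_qoi :: "'a qoi" where
  "top = Abs_qoi LoI"

definition times_qoi :: "'a qoi \<Rightarrow> 'a qoi \<Rightarrow> 'a qoi" where
  "m * n = Abs_qoi (tc (joins (Rep_qoi m) (Rep_qoi n)))"

text \<open>\<open>UNIV\<close> is the total relation \<open>All\<close>.\<close>

definition one_qoi :: "'a qoi" where
  "1 = Abs_qoi {UNIV}"

instance
proof -
  have Rep_Sup: "Rep_qoi (Sup X) = tc (\<Union>m\<in>X. Rep_qoi m)" for X :: "'a qoi set"
    unfolding Sup_qoi_def by (rule Rep_Abs_tc) (use Rep_qoi_subset in blast)
  have Rep_times: "Rep_qoi (m * n) = tc (joins (Rep_qoi m) (Rep_qoi n))" for m n :: "'a qoi"
    unfolding times_qoi_def by (intro Rep_Abs_tc joins_subset Rep_qoi_subset)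
  have tc_one: "tc {UNIV} = {UNIV :: ('a \<times> 'a) set}"
  proof -
    have U: "{UNIV} \<subseteq> (LoI :: ('a \<times> 'a) set set)"
      by (auto simp: LoI_def equiv_def refl_on_def sym_def trans_def)
    have "Q = UNIV" if "Q \<in> tc {UNIV}" for Q :: "('a \<times> 'a) set"
    proof -
      obtain R where "R \<subseteq> Q" "\<forall>x. R `` {x} = UNIV `` {x}"
        using \<open>Q \<in> tc {UNIV}\<close> unfolding tc_iff[OF U] by blast
      then show ?thesis by auto
    qed
    with tc_extensive[OF U] show ?thesis by auto
  qed
  have Rep_one: "Rep_qoi 1 = {UNIV :: ('a \<times> 'a) set}"
    unfolding one_qoi_def using tc_one tc_subset[of "{UNIV :: ('a \<times> 'a) set}"]
    by (subst Abs_qoi_inverse) auto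
  have sup_Sup: "sup m n = Sup {m, n}" and inf_Inf: "inf m n = Inf {m, n}" for m n :: "'a qoi"
    by (simp_all add: sup_qoi_def Sup_qoi_def inf_qoi_def Inf_qoi_def)
  have eqI: "m = n" if "Rep_qoi m = Rep_qoi n" for m n :: "'a qoi"
    using that by (simp add: Rep_qoi_inject)
  have Sup_upper: "x \<le> Sup A" if "x \<in> A" for x :: "'a qoi" and A
  proof -
    have "(\<Union>m\<in>A. Rep_qoi m) \<subseteq> LoI" using Rep_qoi_subset by blast
    from tc_extensive[OF this] that show ?thesis
      unfolding less_eq_qoi_def Rep_Sup by blast
  qed
  have Sup_least: "Sup A \<le> z" if "\<And>x. x \<in> A \<Longrightarrow> x \<le> z" for z :: "'a qoi" and A
  proof -
    have "(\<Union>m\<in>A. Rep_qoi m) \<subseteq> Rep_qoi z" using that by (auto simp: less_eq_qoi_def)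
    from tc_mono[OF this] show ?thesis
      unfolding less_eq_qoi_def Rep_Sup tc_Rep_qoi .
  qed
  have Rep_Inf: "Rep_qoi (Inf X) = LoI \<inter> (\<Inter>m\<in>X. Rep_qoi m)" for X :: "'a qoi set"
  proof -
    let ?I = "LoI \<inter> (\<Inter>m\<in>X. Rep_qoi m)"
    have "tc ?I \<subseteq> Rep_qoi m" if "m \<in> X" for m
      using tc_mono[of ?I "Rep_qoi m"] that by (auto simp: tc_Rep_qoi)
    then have "tc ?I = ?I"
      using tc_subset[of ?I] tc_extensive[of ?I] by blast
    then show ?thesis
      unfolding Inf_qoi_def by (intro Abs_qoi_inverse) blast
  qed
  have Inf_lower: "Inf A \<le> x" if "x \<in> A" for x :: "'a qoi" and A
    unfolding less_eq_qoi_def Rep_Inf using that by blast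
  have Inf_greatest: "z \<le> Inf A" if "\<And>x. x \<in> A \<Longrightarrow> z \<le> x" for z :: "'a qoi" and A
    using that Rep_qoi_subset[of z] unfolding less_eq_qoi_def Rep_Inf by blast
  show "OFCLASS('a qoi, comm_quantale_class)"
  proof
    fix a b c x y z :: "'a qoi" and A :: "'a qoi set"
    show "x < y \<longleftrightarrow> x \<le> y \<and> \<not> y \<le> x" "x \<le> x"
      by (auto simp: less_eq_qoi_def less_qoi_def)
    show "x \<le> y \<Longrightarrow> y \<le> z \<Longrightarrow> x \<le> z"
      by (auto simp: less_eq_qoi_def)
    show "x \<le> y \<Longrightarrow> y \<le> x \<Longrightarrow> x = y"
      by (rule eqI) (auto simp: less_eq_qoi_def)
    show "inf x y \<le> x" "inf x y \<le> y" "x \<le> y \<Longrightarrow> x \<le> z \<Longrightarrow> x \<le> inf y z"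
      unfolding inf_Inf by (auto intro: Inf_lower Inf_greatest)
    show "x \<le> sup x y" "y \<le> sup x y" "y \<le> x \<Longrightarrow> z \<le> x \<Longrightarrow> sup y z \<le> x"
      unfolding sup_Sup by (auto intro: Sup_upper Sup_least)
    show "x \<in> A \<Longrightarrow> Inf A \<le> x" "(\<And>x. x \<in> A \<Longrightarrow> z \<le> x) \<Longrightarrow> z \<le> Inf A"
      using Inf_lower Inf_greatest by blast+
    show "x \<in> A \<Longrightarrow> x \<le> Sup A" "(\<And>x. x \<in> A \<Longrightarrow> x \<le> z) \<Longrightarrow> Sup A \<le> z"
      using Sup_upper Sup_least by blast+
    show "Inf {} = (top :: 'a qoi)" "Sup {} = (bot :: 'a qoi)"
      by (simp_all add: top_qoi_def bot_qoi_def Sup_qoi_def Inf_qoi_def)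
    show comm: "a * b = b * a" for a b :: "'a qoi"
      by (simp add: times_qoi_def joins_commute)
    have assoc1: "Rep_qoi (a * (b * c)) = tc (joins (Rep_qoi a) (joins (Rep_qoi b) (Rep_qoi c)))"
      for a b c :: "'a qoi"
      unfolding Rep_times by (intro tc_joins_tc joins_subset Rep_qoi_subset)
    show "a * b * c = a * (b * c)"
    proof (rule eqI)
      have "Rep_qoi (a * b * c) = Rep_qoi (c * (a * b))"
        by (simp add: comm)
      also have "\<dots> = tc (joins (joins (Rep_qoi a) (Rep_qoi b)) (Rep_qoi c))"
        by (simp add: assoc1 joins_commute)
      also have "\<dots> = Rep_qoi (a * (b * c))"
        by (simp add: assoc1 joins_assoc)
      finally show "Rep_qoi (a * b * c) = Rep_qoi (a * (b * c))" .
    qed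
    show "1 * a = a"
    proof (rule eqI)
      have "joins {UNIV} (Rep_qoi a) = Rep_qoi a"
        by (auto simp: joins_def)
      then show "Rep_qoi (1 * a) = Rep_qoi a"
        by (simp add: Rep_times Rep_one tc_Rep_qoi)
    qed
    show "x * Sup A = Sup ((*) x ` A)"
    proof (rule eqI)
      have "Rep_qoi (x * Sup A) = tc (joins (Rep_qoi x) (\<Union>m\<in>A. Rep_qoi m))"
        unfolding Rep_times Rep_Sup by (rule tc_joins_tc) (use Rep_qoi_subset in blast)+
      also have "joins (Rep_qoi x) (\<Union>m\<in>A. Rep_qoi m) =
          \<Union>((\<lambda>m. joins (Rep_qoi x) (Rep_qoi m)) ` A)"
        by (auto simp: joins_def)
      also have "tc \<dots> = tc (\<Union>(tc ` (\<lambda>m. joins (Rep_qoi x) (Rep_qoi m)) ` A))"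
        by (rule tc_Union_tc[symmetric]) (use Rep_qoi_subset joins_subset in blast)
      also have "\<dots> = Rep_qoi (Sup ((*) x ` A))"
        by (simp add: Rep_Sup Rep_times image_image)
      finally show "Rep_qoi (x * Sup A) = Rep_qoi (Sup ((*) x ` A))" .
    qed
  qed
qed

end


section \<open>The universal objects\<close>

definition down :: "'a::order set \<Rightarrow> 'a set" where
  "down X = {y. \<exists>x\<in>X. y \<le> x}"

lemma down_extensive: "X \<subseteq> down X"
  by (auto simp: down_def)

lemma down_down: "down (down X) = down X"
  by (auto simp: down_def intro: order.trans)

lemma down_mono: "X \<subseteq> Y \<Longrightarrow> down X \<subseteq> down Y"
  by (auto simp: down_def)

lemma down_closed: "down X = X \<Longrightarrow> x \<in> X \<Longrightarrow> y \<le> x \<Longrightarrow> y \<in> X"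
  unfolding down_def by blast

lemma down_eqI: "(\<And>x y. x \<in> X \<Longrightarrow> y \<le> x \<Longrightarrow> y \<in> X) \<Longrightarrow> down X = X"
  unfolding down_def by (intro set_eqI iffI) (auto intro: order.refl)

lemma down_Union: "(\<And>X. X \<in> A \<Longrightarrow> down X = X) \<Longrightarrow> down (\<Union>A) = \<Union>A"
  by (rule down_eqI) (meson UnionE UnionI down_closed)

lemma down_Inter: "(\<And>X. X \<in> A \<Longrightarrow> down X = X) \<Longrightarrow> down (\<Inter>A) = \<Inter>A"
  by (rule down_eqI) (meson InterD InterI down_closed)

typedef 'v unat = "{M :: ('v \<Rightarrow> nat) set. down M = M}"
  by (rule exI[of _ "{}"]) (simp add: down_def)

typedef 'v uset = "{X :: 'v set set. down X = X}"
  by (rule exI[of _ "{}"]) (simp add: down_def)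

lemma down_Rep_unat: "down (Rep_unat m) = Rep_unat m"
  using Rep_unat[of m] by simp

lemma down_Rep_uset: "down (Rep_uset m) = Rep_uset m"
  using Rep_uset[of m] by simp

definition plus_sets :: "('v \<Rightarrow> nat) set \<Rightarrow> ('v \<Rightarrow> nat) set \<Rightarrow> ('v \<Rightarrow> nat) set" where
  "plus_sets M N = {(\<lambda>v. m v + n v) | m n. m \<in> M \<and> n \<in> N}"

definition union_sets :: "'v set set \<Rightarrow> 'v set set \<Rightarrow> 'v set set" where
  "union_sets \<X> \<Y> = {X \<union> Y | X Y. X \<in> \<X> \<and> Y \<in> \<Y>}"

lemma plus_setsI: "a \<in> A \<Longrightarrow> b \<in> B \<Longrightarrow> (\<lambda>v. a v + b v) \<in> plus_sets A B"
  unfolding plus_sets_def by blast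

lemma plus_setsE:
  assumes "x \<in> plus_sets A B"
  obtains a b where "a \<in> A" "b \<in> B" "x = (\<lambda>v. a v + b v)"
  using assms unfolding plus_sets_def by blast

lemma plus_sets_mono: "A \<subseteq> A' \<Longrightarrow> B \<subseteq> B' \<Longrightarrow> plus_sets A B \<subseteq> plus_sets A' B'"
  unfolding plus_sets_def by blast

lemma down_plus_sets_down: "down (plus_sets M (down N)) = down (plus_sets M N)"
proof
  show "down (plus_sets M (down N)) \<subseteq> down (plus_sets M N)"
  proof
    fix k assume "k \<in> down (plus_sets M (down N))"
    then obtain z where z: "z \<in> plus_sets M (down N)" "k \<le> z"
      unfolding down_def[of "plus_sets M (down N)"] by blast
    from z(1) obtain m n where mn: "m \<in> M" "n \<in> down N" "z = (\<lambda>v. m v + n v)"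
      by (rule plus_setsE)
    from mn(2) obtain n' where n': "n' \<in> N" "n \<le> n'"
      unfolding down_def by blast
    have "z \<le> (\<lambda>v. m v + n' v)"
      using n'(2) by (simp add: mn(3) le_fun_def)
    with z(2) have "k \<le> (\<lambda>v. m v + n' v)"
      by (rule order.trans)
    with plus_setsI[OF mn(1) n'(1)] show "k \<in> down (plus_sets M N)"
      unfolding down_def by blast
  qed
  show "down (plus_sets M N) \<subseteq> down (plus_sets M (down N))"
    by (intro down_mono plus_sets_mono order.refl down_extensive)
qed

lemma plus_sets_commute: "plus_sets M N = plus_sets N M"
proof -
  have "plus_sets M N \<subseteq> plus_sets N M" for M N :: "('a \<Rightarrow> nat) set"
  proof
    fix k assume "k \<in> plus_sets M N"
    then obtain m n where "m \<in> M" "n \<in> N" and k: "k = (\<lambda>v. m v + n v)"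
      by (rule plus_setsE)
    then have "(\<lambda>v. n v + m v) \<in> plus_sets N M"
      by (intro plus_setsI)
    then show "k \<in> plus_sets N M"
      by (simp only: k add.commute)
  qed
  then show ?thesis by blast
qed

lemma plus_sets_assoc: "plus_sets (plus_sets A B) C = plus_sets A (plus_sets B C)"
proof (intro set_eqI iffI)
  fix x assume "x \<in> plus_sets (plus_sets A B) C"
  then obtain a b c where "a \<in> A" "b \<in> B" "c \<in> C" and x: "x = (\<lambda>v. a v + b v + c v)"
    by (elim plus_setsE) simp
  then have "(\<lambda>v. a v + (b v + c v)) \<in> plus_sets A (plus_sets B C)"
    using plus_setsI[OF _ plus_setsI[of b B c C], of a A] by simp
  then show "x \<in> plus_sets A (plus_sets B C)"
    by (simp only: x add.assoc)
next
  fix x assume "x \<in> plus_sets A (plus_sets B C)"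
  then obtain a b c where "a \<in> A" "b \<in> B" "c \<in> C" and x: "x = (\<lambda>v. a v + (b v + c v))"
    by (elim plus_setsE) simp
  then have "(\<lambda>v. a v + b v + c v) \<in> plus_sets (plus_sets A B) C"
    using plus_setsI[OF plus_setsI[of a A b B], of c C] by simp
  then show "x \<in> plus_sets (plus_sets A B) C"
    by (simp only: x add.assoc)
qed

lemma union_setsI: "a \<in> A \<Longrightarrow> b \<in> B \<Longrightarrow> a \<union> b \<in> union_sets A B"
  unfolding union_sets_def by blast

lemma union_setsE:
  assumes "x \<in> union_sets A B"
  obtains a b where "a \<in> A" "b \<in> B" "x = a \<union> b"
  using assms unfolding union_sets_def by blast

lemma union_sets_mono: "A \<subseteq> A' \<Longrightarrow> B \<subseteq> B' \<Longrightarrow> union_sets A B \<subseteq> union_sets A' B'"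
  unfolding union_sets_def by blast

lemma down_union_sets_down: "down (union_sets \<X> (down \<Y>)) = down (union_sets \<X> \<Y>)"
proof
  show "down (union_sets \<X> (down \<Y>)) \<subseteq> down (union_sets \<X> \<Y>)"
  proof
    fix Z assume "Z \<in> down (union_sets \<X> (down \<Y>))"
    then obtain V where V: "V \<in> union_sets \<X> (down \<Y>)" "Z \<subseteq> V"
      unfolding down_def[of "union_sets \<X> (down \<Y>)"] by blast
    from V(1) obtain X Y where XY: "X \<in> \<X>" "Y \<in> down \<Y>" "V = X \<union> Y"
      by (rule union_setsE)
    from XY(2) obtain Y' where Y': "Y' \<in> \<Y>" "Y \<subseteq> Y'"
      unfolding down_def by blast
    have "Z \<subseteq> X \<union> Y'"
      using V(2) XY(3) Y'(2) by blast
    with union_setsI[OF XY(1) Y'(1)] show "Z \<in> down (union_sets \<X> \<Y>)"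
      unfolding down_def by blast
  qed
  show "down (union_sets \<X> \<Y>) \<subseteq> down (union_sets \<X> (down \<Y>))"
    by (intro down_mono union_sets_mono order.refl down_extensive)
qed

lemma union_sets_commute: "union_sets \<X> \<Y> = union_sets \<Y> \<X>"
  by (auto simp: union_sets_def)

lemma union_sets_assoc: "union_sets (union_sets A B) C = union_sets A (union_sets B C)"
proof (intro set_eqI iffI)
  fix x assume "x \<in> union_sets (union_sets A B) C"
  then obtain a b c where "a \<in> A" "b \<in> B" "c \<in> C" and x: "x = (a \<union> b) \<union> c"
    by (elim union_setsE) simp
  then have "a \<union> (b \<union> c) \<in> union_sets A (union_sets B C)"
    using union_setsI[OF _ union_setsI[of b B c C], of a A] by simp
  then show "x \<in> union_sets A (union_sets B C)"
    by (simp only: x Un_assoc)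
next
  fix x assume "x \<in> union_sets A (union_sets B C)"
  then obtain a b c where "a \<in> A" "b \<in> B" "c \<in> C" and x: "x = a \<union> (b \<union> c)"
    by (elim union_setsE) simp
  then have "(a \<union> b) \<union> c \<in> union_sets (union_sets A B) C"
    using union_setsI[OF union_setsI[of a A b B], of c C] by simp
  then show "x \<in> union_sets (union_sets A B) C"
    by (simp only: x Un_assoc)
qed

lemma down_plus_sets_UN:
  "down (plus_sets M (\<Union>x\<in>A. f x)) = (\<Union>x\<in>A. down (plus_sets M (f x)))"
proof -
  have "plus_sets M (\<Union>x\<in>A. f x) = (\<Union>x\<in>A. plus_sets M (f x))"
    unfolding plus_sets_def by blast
  then show ?thesis
    by (auto simp: down_def)
qed

lemma down_union_sets_UN:
  "down (union_sets \<X> (\<Union>x\<in>A. f x)) = (\<Union>x\<in>A. down (union_sets \<X> (f x)))"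
proof -
  have "union_sets \<X> (\<Union>x\<in>A. f x) = (\<Union>x\<in>A. union_sets \<X> (f x))"
    unfolding union_sets_def by blast
  then show ?thesis
    by (auto simp: down_def)
qed

instantiation unat :: (type) comm_quantale
begin

definition less_eq_unat :: "'a unat \<Rightarrow> 'a unat \<Rightarrow> bool" where
  "M \<le> N \<longleftrightarrow> Rep_unat M \<subseteq> Rep_unat N"

definition less_unat :: "'a unat \<Rightarrow> 'a unat \<Rightarrow> bool" where
  "M < N \<longleftrightarrow> Rep_unat M \<subset> Rep_unat N"

definition Sup_unat :: "'a unat set \<Rightarrow> 'a unat" where
  "Sup A = Abs_unat (\<Union>M\<in>A. Rep_unat M)"

definition Inf_unat :: "'a unat set \<Rightarrow> 'a unat" where
  "Inf A = Abs_unat (\<Inter>M\<in>A. Rep_unat M)"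

definition sup_unat :: "'a unat \<Rightarrow> 'a unat \<Rightarrow> 'a unat" where
  "sup M N = Abs_unat (Rep_unat M \<union> Rep_unat N)"

definition inf_unat :: "'a unat \<Rightarrow> 'a unat \<Rightarrow> 'a unat" where
  "inf M N = Abs_unat (Rep_unat M \<inter> Rep_unat N)"

definition bot_unat :: "'a unat" where
  "bot = Abs_unat {}"

definition top_unat :: "'a unat" where
  "top = Abs_unat UNIV"

definition times_unat :: "'a unat \<Rightarrow> 'a unat \<Rightarrow> 'a unat" where
  "M * N = Abs_unat (down (plus_sets (Rep_unat M) (Rep_unat N)))"

definition one_unat :: "'a unat" where
  "1 = Abs_unat (down {\<lambda>_. 0})"

instance
proof -
  have Rep_Sup: "Rep_unat (Sup A) = (\<Union>M\<in>A. Rep_unat M)" for A :: "'a unat set"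
    unfolding Sup_unat_def
    by (rule Abs_unat_inverse) (auto intro!: down_Union simp: down_Rep_unat)
  have Rep_Inf: "Rep_unat (Inf A) = (\<Inter>M\<in>A. Rep_unat M)" for A :: "'a unat set"
    unfolding Inf_unat_def
    by (rule Abs_unat_inverse) (auto intro!: down_Inter simp: down_Rep_unat)
  have Rep_times: "Rep_unat (M * N) = down (plus_sets (Rep_unat M) (Rep_unat N))"
    for M N :: "'a unat"
    unfolding times_unat_def by (rule Abs_unat_inverse) (simp add: down_down)
  have Rep_one: "Rep_unat 1 = down {\<lambda>_::'a. 0}"
    unfolding one_unat_def by (rule Abs_unat_inverse) (simp add: down_down)
  have sup_Sup: "sup m n = Sup {m, n}" and inf_Inf: "inf m n = Inf {m, n}" for m n :: "'a unat"
    by (simp_all add: sup_unat_def Sup_unat_def inf_unat_def Inf_unat_def)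
  have bot_Sup: "bot = Sup ({} :: 'a unat set)" and top_Inf: "top = Inf ({} :: 'a unat set)"
    by (simp_all add: bot_unat_def Sup_unat_def top_unat_def Inf_unat_def)
  note defs = less_eq_unat_def less_unat_def sup_Sup inf_Inf bot_Sup top_Inf Rep_Sup Rep_Inf
  have eqI: "M = N" if "Rep_unat M = Rep_unat N" for M N :: "'a unat"
    using that by (simp add: Rep_unat_inject)
  show "OFCLASS('a unat, comm_quantale_class)"
  proof
    fix a b c x y z :: "'a unat" and A :: "'a unat set"
    show "x \<le> y \<Longrightarrow> y \<le> x \<Longrightarrow> x = y"
      by (rule eqI) (auto simp: defs)
    show comm: "a * b = b * a" for a b :: "'a unat"
      by (simp add: times_unat_def plus_sets_commute)
    have assoc1: "Rep_unat (a * (b * c)) =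
        down (plus_sets (Rep_unat a) (plus_sets (Rep_unat b) (Rep_unat c)))" for a b c :: "'a unat"
      unfolding Rep_times by (rule down_plus_sets_down)
    show "a * b * c = a * (b * c)"
    proof (rule eqI)
      have "Rep_unat (a * b * c) = Rep_unat (c * (a * b))"
        by (simp add: comm)
      also have "\<dots> = down (plus_sets (plus_sets (Rep_unat a) (Rep_unat b)) (Rep_unat c))"
        by (subst plus_sets_commute) (rule assoc1)
      also have "\<dots> = Rep_unat (a * (b * c))"
        by (simp add: assoc1 plus_sets_assoc)
      finally show "Rep_unat (a * b * c) = Rep_unat (a * (b * c))" .
    qed
    show "1 * a = a"
    proof (rule eqI)
      have "Rep_unat (1 * a) = down (plus_sets (Rep_unat a) {\<lambda>_. 0})"
        by (simp add: Rep_times Rep_one plus_sets_commute[of "down _"] down_plus_sets_down)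
      also have "plus_sets (Rep_unat a) {\<lambda>_. 0} = Rep_unat a"
        by (auto simp: plus_sets_def)
      finally show "Rep_unat (1 * a) = Rep_unat a"
        by (simp add: down_Rep_unat)
    qed
    show "x * Sup A = Sup ((*) x ` A)"
      by (rule eqI) (simp add: Rep_Sup Rep_times down_plus_sets_UN)
  qed (auto simp: defs)
qed

end

instantiation uset :: (type) comm_quantale
begin

definition less_eq_uset :: "'a uset \<Rightarrow> 'a uset \<Rightarrow> bool" where
  "X \<le> Y \<longleftrightarrow> Rep_uset X \<subseteq> Rep_uset Y"

definition less_uset :: "'a uset \<Rightarrow> 'a uset \<Rightarrow> bool" where
  "X < Y \<longleftrightarrow> Rep_uset X \<subset> Rep_uset Y"

definition Sup_uset :: "'a uset set \<Rightarrow> 'a uset" where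
  "Sup A = Abs_uset (\<Union>X\<in>A. Rep_uset X)"

definition Inf_uset :: "'a uset set \<Rightarrow> 'a uset" where
  "Inf A = Abs_uset (\<Inter>X\<in>A. Rep_uset X)"

definition sup_uset :: "'a uset \<Rightarrow> 'a uset \<Rightarrow> 'a uset" where
  "sup X Y = Abs_uset (Rep_uset X \<union> Rep_uset Y)"

definition inf_uset :: "'a uset \<Rightarrow> 'a uset \<Rightarrow> 'a uset" where
  "inf X Y = Abs_uset (Rep_uset X \<inter> Rep_uset Y)"

definition bot_uset :: "'a uset" where
  "bot = Abs_uset {}"

definition top_uset :: "'a uset" where
  "top = Abs_uset UNIV"

definition times_uset :: "'a uset \<Rightarrow> 'a uset \<Rightarrow> 'a uset" where
  "X * Y = Abs_uset (down (union_sets (Rep_uset X) (Rep_uset Y)))"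

definition one_uset :: "'a uset" where
  "1 = Abs_uset (down {{}})"

instance
proof -
  have Rep_Sup: "Rep_uset (Sup A) = (\<Union>X\<in>A. Rep_uset X)" for A :: "'a uset set"
    unfolding Sup_uset_def
    by (rule Abs_uset_inverse) (auto intro!: down_Union simp: down_Rep_uset)
  have Rep_Inf: "Rep_uset (Inf A) = (\<Inter>X\<in>A. Rep_uset X)" for A :: "'a uset set"
    unfolding Inf_uset_def
    by (rule Abs_uset_inverse) (auto intro!: down_Inter simp: down_Rep_uset)
  have Rep_times: "Rep_uset (X * Y) = down (union_sets (Rep_uset X) (Rep_uset Y))"
    for X Y :: "'a uset"
    unfolding times_uset_def by (rule Abs_uset_inverse) (simp add: down_down)
  have Rep_one: "Rep_uset 1 = down {{} :: 'a set}"
    unfolding one_uset_def by (rule Abs_uset_inverse) (simp add: down_down)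
  have sup_Sup: "sup m n = Sup {m, n}" and inf_Inf: "inf m n = Inf {m, n}" for m n :: "'a uset"
    by (simp_all add: sup_uset_def Sup_uset_def inf_uset_def Inf_uset_def)
  have bot_Sup: "bot = Sup ({} :: 'a uset set)" and top_Inf: "top = Inf ({} :: 'a uset set)"
    by (simp_all add: bot_uset_def Sup_uset_def top_uset_def Inf_uset_def)
  note defs = less_eq_uset_def less_uset_def sup_Sup inf_Inf bot_Sup top_Inf Rep_Sup Rep_Inf
  have eqI: "M = N" if "Rep_uset M = Rep_uset N" for M N :: "'a uset"
    using that by (simp add: Rep_uset_inject)
  show "OFCLASS('a uset, comm_quantale_class)"
  proof
    fix a b c x y z :: "'a uset" and A :: "'a uset set"
    show "x \<le> y \<Longrightarrow> y \<le> x \<Longrightarrow> x = y"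
      by (rule eqI) (auto simp: defs)
    show comm: "a * b = b * a" for a b :: "'a uset"
      by (simp add: times_uset_def union_sets_commute)
    have assoc1: "Rep_uset (a * (b * c)) =
        down (union_sets (Rep_uset a) (union_sets (Rep_uset b) (Rep_uset c)))" for a b c :: "'a uset"
      unfolding Rep_times by (rule down_union_sets_down)
    show "a * b * c = a * (b * c)"
    proof (rule eqI)
      have "Rep_uset (a * b * c) = Rep_uset (c * (a * b))"
        by (simp add: comm)
      also have "\<dots> = down (union_sets (union_sets (Rep_uset a) (Rep_uset b)) (Rep_uset c))"
        by (subst union_sets_commute) (rule assoc1)
      also have "\<dots> = Rep_uset (a * (b * c))"
        by (simp add: assoc1 union_sets_assoc)
      finally show "Rep_uset (a * b * c) = Rep_uset (a * (b * c))" .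
    qed
    show "1 * a = a"
    proof (rule eqI)
      have "Rep_uset (1 * a) = down (union_sets (Rep_uset a) {{}})"
        by (simp add: Rep_times Rep_one union_sets_commute[of "down _"] down_union_sets_down)
      also have "union_sets (Rep_uset a) {{}} = Rep_uset a"
        by (auto simp: union_sets_def)
      finally show "Rep_uset (1 * a) = Rep_uset a"
        by (simp add: down_Rep_uset)
    qed
    show "x * Sup A = Sup ((*) x ` A)"
      by (rule eqI) (simp add: Rep_Sup Rep_times down_union_sets_UN)
  qed (auto simp: defs)
qed

end

definition gen_nat :: "'v \<Rightarrow> 'v unat" where
  "gen_nat v = Abs_unat (down {\<lambda>w. if w = v then 1 else 0})"

definition gen_set :: "'v \<Rightarrow> 'v uset" where
  "gen_set v = Abs_uset (down {{v}})"

definition alpha_nat :: "('v::finite \<Rightarrow> 'm::comm_quantale) \<Rightarrow> 'v unat \<Rightarrow> 'm" where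
  "alpha_nat \<sigma> M = (SUP m\<in>Rep_unat M. \<Prod>v\<in>UNIV. \<sigma> v ^ m v)"

definition alpha_set :: "('v::finite \<Rightarrow> 'm::comm_quantale) \<Rightarrow> 'v uset \<Rightarrow> 'm" where
  "alpha_set \<sigma> \<X> = (SUP X\<in>Rep_uset \<X>. \<Prod>v\<in>X. \<sigma> v)"

definition Delta_nat :: "('e \<Rightarrow> 'v set) \<Rightarrow> ('v, 'e) com \<Rightarrow> 'v \<Rightarrow> 'v unat" where
  "Delta_nat fv C = alg fv C 1 gen_nat"

definition Delta_set :: "('e \<Rightarrow> 'v set) \<Rightarrow> ('v, 'e) com \<Rightarrow> 'v \<Rightarrow> 'v uset" where
  "Delta_set fv C = alg fv C 1 gen_set"

definition J_nat :: "('e \<Rightarrow> 'v set) \<Rightarrow> ('v, 'e) com \<Rightarrow> 'v set \<Rightarrow> 'v unat" where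
  "J_nat fv C W = (\<Prod>w\<in>W. Delta_nat fv C w)"

definition J_set :: "('e \<Rightarrow> 'v set) \<Rightarrow> ('v, 'e) com \<Rightarrow> 'v set \<Rightarrow> 'v uset" where
  "J_set fv C W = (\<Prod>w\<in>W. Delta_set fv C w)"

end

theory Submission
  imports Defs
begin

text \<open>
  When all labels are above \<open>1\<close>, \<open>alpha_nat \<sigma>\<close> is a quantale homomorphism, and so is
  \<open>alpha_set \<sigma>\<close> if moreover the labels are idempotent. Homomorphisms
  commute with the algorithmic system (loops by fixed-point fusion), so for idempotent labels both
  sides of the equation are the result of running the system directly from \<open>\<sigma>\<close>.
  Conversely, \<open>if v (v := v) (v := v)\<close> yields \<open>\<sigma> v\<close> on the left and \<open>(\<sigma> v)\<^sup>3\<close> on the right,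
  which for a label above \<open>1\<close> forces idempotence. In \<open>QoI(D)\<close> an idempotent is closed under
  intersection of relations, hence by finiteness it contains its finest member or is empty.
\<close>

section \<open>Fixed-point fusion and quantale homomorphisms\<close>

text \<open>A sup-preserving \<open>h\<close> has a right adjoint, whose value at
  \<open>lfp G\<close> is a pre-fixed point of \<open>F\<close>, hence above \<open>lfp F\<close>.
  Conversely, \<open>h (lfp F)\<close> is a fixed point of \<open>G\<close>.\<close>

lemma lfp_fusion:
  fixes h :: "'a::complete_lattice \<Rightarrow> 'b::complete_lattice"
  assumes h_Sup: "\<And>A. h (Sup A) = Sup (h ` A)"
    and F: "mono F" and G: "mono G" and commute: "\<And>x. h (F x) = G (h x)"
  shows "h (lfp F) = lfp G"
proof (rule antisym)
  have mono_h: "h x \<le> h y" if "x \<le> y" for x y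
    using h_Sup[of "{x, y}"] that by (simp add: le_iff_sup)
  \<comment> \<open>the value at \<open>lfp G\<close> of the right adjoint of \<open>h\<close>\<close>
  define k where "k = Sup {x. h x \<le> lfp G}"
  have "h k \<le> lfp G"
    unfolding k_def h_Sup by (rule Sup_least) blast
  then have "G (h k) \<le> G (lfp G)"
    by (rule monoD[OF G])
  then have "h (F k) \<le> lfp G"
    by (simp add: commute lfp_fixpoint[OF G])
  then have "F k \<le> k"
    unfolding k_def by (intro Sup_upper) simp
  then have "lfp F \<le> k"
    by (rule lfp_lowerbound)
  then show "h (lfp F) \<le> lfp G"
    using \<open>h k \<le> lfp G\<close> mono_h order.trans by blast
  show "lfp G \<le> h (lfp F)"
    by (rule lfp_lowerbound) (simp add: commute[symmetric] lfp_fixpoint[OF F])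
qed

locale quantale_hom =
  fixes h :: "'a::comm_quantale \<Rightarrow> 'b::comm_quantale"
  assumes hom_Sup: "h (Sup A) = Sup (h ` A)"
    and hom_mult: "h (x * y) = h x * h y"
    and hom_one: "h 1 = 1"
begin

lemma hom_sup: "h (sup x y) = sup (h x) (h y)"
  using hom_Sup[of "{x, y}"] by simp

lemma hom_prod: "h (prod f A) = (\<Prod>a\<in>A. h (f a))"
  by (induction A rule: infinite_finite_induct) (simp_all add: hom_one hom_mult)

lemma hom_power: "h (x ^ n) = h x ^ n"
  by (induction n) (simp_all add: hom_one hom_mult)

lemma hom_star: "h (star x) = star (h x)"
  by (simp add: star_def hom_Sup image_image hom_power)

lemma hom_tE: "h (tE fv E \<Gamma>) = tE fv E (h \<circ> \<Gamma>)"
  by (simp add: tE_def hom_prod)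

lemma hom_alg:
  fixes \<Gamma> :: "'v \<Rightarrow> 'a"
  shows "h \<circ> alg fv C p \<Gamma> = alg fv C (h p) (h \<circ> \<Gamma>)"
proof (induction C arbitrary: p \<Gamma>)
  case (While E C)
  have "h \<circ> lfp (\<lambda>\<Theta>. sup \<Gamma> (alg fv C (p * tE fv E \<Theta>) \<Theta>)) =
      lfp (\<lambda>\<Theta>. sup (h \<circ> \<Gamma>) (alg fv C (h p * tE fv E \<Theta>) \<Theta>))"
  \<comment> \<open>Suprema of environments are pointwise, so postcomposition with \<open>h\<close>
    preserves them and fusion applies to the lattice of environments.\<close>
  proof (rule lfp_fusion[where h = "(\<circ>) h", OF _ alg_while_mono alg_while_mono])
    show "h \<circ> Sup A = Sup ((\<circ>) h ` A)" for A :: "('v \<Rightarrow> 'a) set"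
      by (rule ext) (simp add: hom_Sup image_image)
    show "h \<circ> sup \<Gamma> (alg fv C (p * tE fv E \<Theta>) \<Theta>) =
        sup (h \<circ> \<Gamma>) (alg fv C (h p * tE fv E (h \<circ> \<Theta>)) (h \<circ> \<Theta>))" for \<Theta>
      unfolding hom_tE[symmetric] hom_mult[symmetric] While.IH[symmetric]
      by (rule ext) (simp add: hom_sup)
  qed
  note fix_eq = this
  show ?case
    unfolding alg.simps Let_def fix_eq[symmetric] hom_tE[symmetric]
    by (rule ext) (simp add: hom_star hom_mult)
next
  case (Cond E C1 C2)
  show ?case
    unfolding alg.simps Let_def hom_tE[symmetric] hom_mult[symmetric] Cond.IH[symmetric]
    by (rule ext) (simp add: hom_mult hom_sup)
next
  case (Assign x E)
  show ?case
    by (rule ext) (simp add: hom_mult hom_tE[unfolded comp_def] o_def)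
next
  case (Seq C1 C2)
  then show ?case
    by simp
qed simp

end

section \<open>Suprema of tensors and over downsets\<close>

lemma Sup_mult_Sup:
  fixes f :: "'i \<Rightarrow> 'm::comm_quantale"
  shows "(SUP a\<in>A. f a) * (SUP b\<in>B. g b) = (SUP a\<in>A. SUP b\<in>B. f a * g b)"
proof -
  have "(SUP a\<in>A. f a) * y = (SUP a\<in>A. f a * y)" for y
    using mult_Sup[of y "f ` A"] by (simp add: image_image mult.commute)
  note distrib = this
  show ?thesis
    unfolding distrib by (simp add: mult_Sup image_image)
qed

text \<open>Every element of \<open>down A\<close> is dominated by one of \<open>A\<close>. This
  discards the closures in the units, tensors and generators of the universal objects.\<close>

lemma SUP_down:
  fixes f :: "'a::order \<Rightarrow> 'b::complete_lattice"
  assumes "\<And>x y. x \<le> y \<Longrightarrow> f x \<le> f y"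
  shows "(SUP x\<in>down A. f x) = (SUP x\<in>A. f x)"
proof (rule antisym)
  show "(SUP x\<in>down A. f x) \<le> (SUP x\<in>A. f x)"
    by (rule SUP_mono) (auto simp: down_def intro: assms)
  show "(SUP x\<in>A. f x) \<le> (SUP x\<in>down A. f x)"
    by (rule SUP_subset_mono[OF down_extensive]) simp
qed

lemma SUP_Union:
  fixes f :: "'a \<Rightarrow> 'b::complete_lattice"
  shows "(SUP x\<in>(\<Union>i\<in>I. X i). f x) = (SUP i\<in>I. SUP x\<in>X i. f x)"
  by (rule antisym) (auto intro!: SUP_least intro: SUP_upper2)

section \<open>The universal objects as sets\<close>

lemma Rep_unat_Sup: "Rep_unat (Sup A) = (\<Union>M\<in>A. Rep_unat M)"
  unfolding Sup_unat_def
  by (rule Abs_unat_inverse) (auto intro!: down_Union simp: down_Rep_unat)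

lemma Rep_unat_mult: "Rep_unat (M * N) = down (plus_sets (Rep_unat M) (Rep_unat N))"
  unfolding times_unat_def by (rule Abs_unat_inverse) (simp add: down_down)

lemma Rep_unat_one: "Rep_unat 1 = down {\<lambda>_. 0}"
  unfolding one_unat_def by (rule Abs_unat_inverse) (simp add: down_down)

lemma Rep_gen_nat: "Rep_unat (gen_nat v) = down {\<lambda>w. if w = v then 1 else 0}"
  unfolding gen_nat_def by (rule Abs_unat_inverse) (simp add: down_down)

lemma Rep_uset_Sup: "Rep_uset (Sup A) = (\<Union>X\<in>A. Rep_uset X)"
  unfolding Sup_uset_def
  by (rule Abs_uset_inverse) (auto intro!: down_Union simp: down_Rep_uset)

lemma Rep_uset_mult: "Rep_uset (X * Y) = down (union_sets (Rep_uset X) (Rep_uset Y))"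
  unfolding times_uset_def by (rule Abs_uset_inverse) (simp add: down_down)

lemma Rep_uset_one: "Rep_uset 1 = down {{}}"
  unfolding one_uset_def by (rule Abs_uset_inverse) (simp add: down_down)

lemma Rep_gen_set: "Rep_uset (gen_set v) = down {{v}}"
  unfolding gen_set_def by (rule Abs_uset_inverse) (simp add: down_down)

text \<open>Union absorbs repetitions, whereas \<open>gen_nat\<close> counts them: this is the
  difference that the converse direction exploits.\<close>

lemma gen_set_idem: "gen_set v * gen_set v = gen_set v"
proof -
  have "union_sets (down {{v}}) {{v}} = {{v}}"
    by (auto simp: union_sets_def down_def)
  then have "Rep_uset (gen_set v * gen_set v) = Rep_uset (gen_set v)"
    by (simp add: Rep_uset_mult Rep_gen_set down_union_sets_down)
  then show ?thesis
    by (simp add: Rep_uset_inject)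
qed

section \<open>Powers and finite products of labels\<close>

lemma power_le_power:
  fixes a :: "'m::comm_quantale"
  assumes "1 \<le> a" "m \<le> n"
  shows "a ^ m \<le> a ^ n"
  using assms(2)
proof (induction n rule: dec_induct)
  case (step n)
  from step.IH mult_mono'[OF assms(1) order.refl[of "a ^ n"]] show ?case
    by simp
qed simp

text \<open>The extra factors over \<open>B - A\<close> are above \<open>1\<close>. Finiteness of
  \<open>B\<close> matters, as a product over an infinite set is \<open>1\<close> by
  default.\<close>

lemma prod_subset_mono:
  fixes f :: "'a \<Rightarrow> 'm::comm_quantale"
  assumes "\<And>v. 1 \<le> f v" "finite B" "A \<subseteq> B"
  shows "prod f A \<le> prod f B"
  using mult_mono'[OF one_le_prod[of "B - A" f] order.refl[of "prod f A"]] assms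
    prod.subset_diff[of A B f] by simp

text \<open>Factors indexed by \<open>A \<inter> B\<close> occur twice on the right and are absorbed
  by idempotence.\<close>

lemma prod_Un_idem:
  fixes f :: "'a \<Rightarrow> 'm::comm_monoid_mult"
  assumes "\<And>v. f v * f v = f v" "finite A" "finite B"
  shows "prod f (A \<union> B) = prod f A * prod f B"
proof -
  \<comment> \<open>Padding with \<open>1\<close> gives both products the same index set, so they
    can be multiplied factor by factor.\<close>
  have A: "prod f A = (\<Prod>v\<in>A \<union> B. if v \<in> A then f v else 1)"
    using assms(2,3) by (intro prod.mono_neutral_cong_left) auto
  have B: "prod f B = (\<Prod>v\<in>A \<union> B. if v \<in> B then f v else 1)"
    using assms(2,3) by (intro prod.mono_neutral_cong_left) auto
  show ?thesis
    unfolding A B prod.distrib[symmetric] by (rule prod.cong) (auto simp: assms(1))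
qed

section \<open>Evaluating the universal objects at a labelling\<close>

context
  fixes \<sigma> :: "'v::finite \<Rightarrow> 'm::comm_quantale"
  assumes one_le: "\<And>v. 1 \<le> \<sigma> v"
begin

lemma monomial_mono: "m \<le> n \<Longrightarrow> (\<Prod>v\<in>UNIV. \<sigma> v ^ m v) \<le> (\<Prod>v\<in>UNIV. \<sigma> v ^ n v)"
  by (rule prod_mono') (simp add: power_le_power one_le le_fun_def)

lemma alpha_nat_hom: "quantale_hom (alpha_nat \<sigma>)"
proof
  show "alpha_nat \<sigma> (Sup A) = Sup (alpha_nat \<sigma> ` A)" for A
    by (simp add: alpha_nat_def Rep_unat_Sup SUP_Union)
  show "alpha_nat \<sigma> 1 = 1"
    by (simp add: alpha_nat_def Rep_unat_one SUP_down[OF monomial_mono])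
  \<comment> \<open>As a union of singletons, the tensor yields the double supremum of
    \<open>Sup_mult_Sup\<close>; adding exponents then multiplies monomials.\<close>
  have plus: "plus_sets M N = (\<Union>m\<in>M. \<Union>n\<in>N. {\<lambda>v. m v + n v})" for M N :: "('v \<Rightarrow> nat) set"
    by (auto simp: plus_sets_def)
  show "alpha_nat \<sigma> (M * N) = alpha_nat \<sigma> M * alpha_nat \<sigma> N" for M N
    by (simp add: alpha_nat_def Rep_unat_mult SUP_down[OF monomial_mono] plus SUP_Union
        Sup_mult_Sup power_add prod.distrib)
qed

lemma alpha_nat_gen: "alpha_nat \<sigma> (gen_nat v) = \<sigma> v"
proof -
  have "(\<Prod>w\<in>UNIV. \<sigma> w ^ (if w = v then 1 else 0)) = \<sigma> v"
    by (simp add: if_distrib[of "power _"] cong: if_cong)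
  then show ?thesis
    by (simp add: alpha_nat_def Rep_gen_nat SUP_down[OF monomial_mono])
qed

lemma alpha_set_gen: "alpha_set \<sigma> (gen_set v) = \<sigma> v"
  by (simp add: alpha_set_def Rep_gen_set SUP_down prod_subset_mono one_le)

lemma alpha_set_hom:
  assumes "\<And>v. \<sigma> v * \<sigma> v = \<sigma> v"
  shows "quantale_hom (alpha_set \<sigma>)"
proof
  show "alpha_set \<sigma> (Sup A) = Sup (alpha_set \<sigma> ` A)" for A
    by (simp add: alpha_set_def Rep_uset_Sup SUP_Union)
  show "alpha_set \<sigma> 1 = 1"
    by (simp add: alpha_set_def Rep_uset_one SUP_down prod_subset_mono one_le)
  have union: "union_sets \<X> \<Y> = (\<Union>X\<in>\<X>. \<Union>Y\<in>\<Y>. {X \<union> Y})" for \<X> \<Y> :: "'v set set"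
    by (auto simp: union_sets_def)
  show "alpha_set \<sigma> (X * Y) = alpha_set \<sigma> X * alpha_set \<sigma> Y" for X Y
    by (simp add: alpha_set_def Rep_uset_mult SUP_down prod_subset_mono one_le union SUP_Union
        Sup_mult_Sup prod_Un_idem assms)
qed

lemma alpha_nat_Delta: "alpha_nat \<sigma> (Delta_nat fv C w) = alg fv C 1 \<sigma> w"
proof -
  interpret quantale_hom "alpha_nat \<sigma>"
    by (rule alpha_nat_hom)
  have "alpha_nat \<sigma> \<circ> gen_nat = \<sigma>"
    by (rule ext) (simp add: alpha_nat_gen)
  then show ?thesis
    using fun_cong[OF hom_alg[of fv C 1 gen_nat], of w] by (simp add: Delta_nat_def hom_one)
qed

lemma alpha_set_Delta:
  assumes "\<And>v. \<sigma> v * \<sigma> v = \<sigma> v"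
  shows "alpha_set \<sigma> (Delta_set fv C w) = alg fv C 1 \<sigma> w"
proof -
  interpret quantale_hom "alpha_set \<sigma>"
    by (rule alpha_set_hom[OF assms])
  have "alpha_set \<sigma> \<circ> gen_set = \<sigma>"
    by (rule ext) (simp add: alpha_set_gen)
  then show ?thesis
    using fun_cong[OF hom_alg[of fv C 1 gen_set], of w] by (simp add: Delta_set_def hom_one)
qed

lemma alpha_J_eq_if_idem:
  assumes "\<And>v. \<sigma> v * \<sigma> v = \<sigma> v"
  shows "alpha_set \<sigma> (J_set fv C W) = alpha_nat \<sigma> (J_nat fv C W)"
  by (simp add: J_set_def J_nat_def quantale_hom.hom_prod[OF alpha_nat_hom]
      quantale_hom.hom_prod[OF alpha_set_hom[OF assms]] alpha_nat_Delta alpha_set_Delta[OF assms])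

lemma idem_if_alpha_J_eq:
  fixes fv :: "'e \<Rightarrow> 'v set"
  assumes E: "fv E = {v}"
    and eq: "\<And>(C :: ('v, 'e) com) W. alpha_set \<sigma> (J_set fv C W) = alpha_nat \<sigma> (J_nat fv C W)"
  shows "\<sigma> v * \<sigma> v = \<sigma> v"
proof (rule antisym)
  define C where "C = Cond E (Assign v E) (Assign v E)"
  \<comment> \<open>One factor comes from the assigned expression, one from the raised
    \<open>p\<close> in the branches, one from the tensor with the guard after them. The quantale is
    left general since both \<open>gen_set\<close> and \<open>\<sigma>\<close> are plugged
    in.\<close>
  have alg_C: "alg fv C 1 \<Gamma> v = \<Gamma> v * (\<Gamma> v * \<Gamma> v)" for \<Gamma> :: "'v \<Rightarrow> 'a::comm_quantale"
    by (simp add: C_def tE_def E Let_def)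
  have "alpha_set \<sigma> (Delta_set fv C v) = alpha_nat \<sigma> (Delta_nat fv C v)"
    using eq[of C "{v}"] by (simp add: J_set_def J_nat_def)
  then have cube: "\<sigma> v = \<sigma> v * (\<sigma> v * \<sigma> v)"
    by (simp add: alpha_nat_Delta alg_C Delta_set_def gen_set_idem alpha_set_gen)
  have "\<sigma> v * \<sigma> v \<le> \<sigma> v * (\<sigma> v * \<sigma> v)"
    using mult_mono'[OF one_le[of v] order.refl[of "\<sigma> v * \<sigma> v"]] by simp
  then show "\<sigma> v * \<sigma> v \<le> \<sigma> v"
    by (simp add: cube[symmetric])
  show "\<sigma> v \<le> \<sigma> v * \<sigma> v"
    using mult_mono'[OF one_le[of v] order.refl[of "\<sigma> v"]] by simp
qed

end

section \<open>Idempotents of QoI(D)\<close>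

lemma UNIV_in_LoI: "UNIV \<in> LoI"
  by (auto simp: LoI_def equiv_def refl_on_def sym_def trans_def)

lemma Rep_qoi_mult: "Rep_qoi (m * n) = tc (joins (Rep_qoi m) (Rep_qoi n))"
  unfolding times_qoi_def by (intro Rep_Abs_tc joins_subset Rep_qoi_subset)

lemma tc_empty: "tc {} = {}"
  by (auto simp: tc_iff)

lemma Rep_qoi_bot: "Rep_qoi bot = {}"
  unfolding bot_qoi_def using Rep_Abs_tc[of "{}"] by (simp add: tc_empty)

text \<open>An empty unit would annihilate every element under the tensor, including the nonempty
  top. This excludes \<open>bot\<close> as a label.\<close>

lemma Rep_qoi_nonempty:
  fixes m :: "'d qoi"
  assumes "1 \<le> m"
  shows "Rep_qoi m \<noteq> {}"
proof
  assume "Rep_qoi m = {}"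
  then have "Rep_qoi (1 :: 'd qoi) = {}"
    using assms by (simp add: less_eq_qoi_def)
  then have "Rep_qoi (1 * n) = {}" for n :: "'d qoi"
    unfolding Rep_qoi_mult by (simp add: joins_def tc_empty)
  moreover have "Rep_qoi (Abs_qoi LoI) = (LoI :: ('d \<times> 'd) set set)"
    by (rule Abs_qoi_inverse) (simp add: tc_LoI)
  ultimately show False
    using UNIV_in_LoI by (metis empty_iff mult_1)
qed

lemma Rep_qoi_down:
  assumes "P \<in> Rep_qoi m"
  shows "loi_down {P} \<subseteq> Rep_qoi m"
proof -
  have "loi_down {P} \<subseteq> tc (Rep_qoi m)"
    unfolding tc_def[of "Rep_qoi m"] mix_def
    using assms Rep_qoi_subset[of m] by (auto simp: loi_down_def)
  then show ?thesis
    by (simp add: tc_Rep_qoi)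
qed

text \<open>Every cell used in a mix contains the \<open>P\<close>-class of each of its points, so
  the mix is again coarser than \<open>P\<close>. Hence principal ideals are elements of
  QoI(D).\<close>

lemma tc_loi_down: "tc (loi_down {P}) = loi_down {P}"
proof
  have L: "loi_down {P} \<subseteq> LoI"
    by (auto simp: loi_down_def)
  then show "loi_down {P} \<subseteq> tc (loi_down {P})"
    by (rule tc_extensive)
  show "tc (loi_down {P}) \<subseteq> loi_down {P}"
  proof
    fix Q assume "Q \<in> tc (loi_down {P})"
    then obtain R where R: "Q \<in> LoI" "R \<subseteq> Q" "\<And>x. \<exists>P'\<in>loi_down {P}. R `` {x} = P' `` {x}"
      unfolding tc_iff[OF L] by blast
    have "(x, y) \<in> R" if "(x, y) \<in> P" for x y
      using R(3)[of x] that by (auto simp: loi_down_def loi_le_def)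
    with R(1,2) show "Q \<in> loi_down {P}"
      by (auto simp: loi_down_def loi_le_def)
  qed
qed

lemma joins_loi_down:
  assumes "P \<in> LoI"
  shows "joins (loi_down {P}) (loi_down {P}) = loi_down {P}"
proof
  show "joins (loi_down {P}) (loi_down {P}) \<subseteq> loi_down {P}"
    by (auto simp: joins_def loi_down_def loi_le_def LoI_Int)
  show "loi_down {P} \<subseteq> joins (loi_down {P}) (loi_down {P})"
    using joinsI by fastforce
qed

lemma qoi_idem_iff:
  fixes m :: "'d::finite qoi"
  shows "m * m = m \<longleftrightarrow> Rep_qoi m = {} \<or> (\<exists>P\<in>LoI. Rep_qoi m = loi_down {P})"
proof
  assume idem: "m * m = m"
  have Int: "P \<inter> Q \<in> Rep_qoi m" if "P \<in> Rep_qoi m" "Q \<in> Rep_qoi m" for P Q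
    using tc_extensive[OF joins_subset[OF Rep_qoi_subset Rep_qoi_subset]] joinsI[OF that]
    by (metis Rep_qoi_mult idem subsetD)
  show "Rep_qoi m = {} \<or> (\<exists>P\<in>LoI. Rep_qoi m = loi_down {P})"
  proof (cases "Rep_qoi m = {}")
    case False
    \<comment> \<open>Finitely many relations exist on \<open>'d\<close>, so closure under binary
      intersection gives the intersection of all members.\<close>
    then have least: "\<Inter>(Rep_qoi m) \<in> Rep_qoi m"
      by (intro finite_Inf_in Int) simp_all
    moreover have "Rep_qoi m \<subseteq> loi_down {\<Inter>(Rep_qoi m)}"
      using Rep_qoi_subset[of m] by (auto simp: loi_down_def loi_le_def)
    ultimately show ?thesis
      using Rep_qoi_down[OF least] Rep_qoi_subset[of m] by blast
  qed simp
next
  assume "Rep_qoi m = {} \<or> (\<exists>P\<in>LoI. Rep_qoi m = loi_down {P})"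
  then have "Rep_qoi (m * m) = Rep_qoi m"
    by (auto simp: Rep_qoi_mult joins_loi_down tc_loi_down tc_empty) (simp add: joins_def tc_empty)
  then show "m * m = m"
    by (simp add: Rep_qoi_inject)
qed

text \<open>Beyond \<open>qoi_idem_iff\<close>, each principal ideal and the empty set must actually
  occur as a value of \<open>Rep_qoi\<close>.\<close>

lemma Rep_qoi_idem_image:
  "Rep_qoi ` {m :: 'd::finite qoi. m * m = m} = {loi_down {P} | P. P \<in> LoI} \<union> {{}}"
proof -
  have "loi_down {P} \<in> range Rep_qoi" for P :: "('d \<times> 'd) set"
    using Abs_qoi_inverse[of "loi_down {P}"] tc_loi_down[of P] tc_subset[of "loi_down {P}"]
    by (intro range_eqI[of _ _ "Abs_qoi (loi_down {P})"]) simp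
  moreover have "{} \<in> range (Rep_qoi :: 'd qoi \<Rightarrow> _)"
    using Rep_qoi_bot by (metis rangeI)
  moreover have "Rep_qoi ` {m :: 'd qoi. m * m = m} =
      {\<P> \<in> range Rep_qoi. \<P> = {} \<or> (\<exists>P\<in>LoI. \<P> = loi_down {P})}"
    unfolding qoi_idem_iff by blast
  ultimately show ?thesis
    by auto
qed

theorem theorem6:
  fixes fv :: "'e \<Rightarrow> 'v::finite set"
    and var :: "'v \<Rightarrow> 'e"
    and \<sigma> :: "'v \<Rightarrow> 'd::finite qoi"
  assumes fv_var: "\<And>v. fv (var v) = {v}"
    and \<sigma>_ge_1: "\<And>v. 1 \<le> \<sigma> v"
  shows "((\<forall>(C :: ('v, 'e) com) W. alpha_set \<sigma> (J_set fv C W) = alpha_nat \<sigma> (J_nat fv C W))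
            \<longleftrightarrow> (\<forall>v. \<sigma> v * \<sigma> v = \<sigma> v))
       \<and> Rep_qoi ` {m :: 'd qoi. m * m = m} = {loi_down {P} | P. P \<in> LoI} \<union> {{}}
       \<and> Rep_qoi (bot :: 'd qoi) = {}
       \<and> ((\<forall>v. \<sigma> v * \<sigma> v = \<sigma> v) \<longleftrightarrow> (\<forall>v. \<exists>P\<in>LoI. Rep_qoi (\<sigma> v) = loi_down {P}))"
proof (intro conjI Rep_qoi_idem_image Rep_qoi_bot iffI allI)
  fix v
  assume "\<forall>(C :: ('v, 'e) com) W. alpha_set \<sigma> (J_set fv C W) = alpha_nat \<sigma> (J_nat fv C W)"
  then show "\<sigma> v * \<sigma> v = \<sigma> v"
    \<comment> \<open>The expression \<open>var v\<close> serves as guard and as assigned expression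
      of the test command.\<close>
    by (intro idem_if_alpha_J_eq[of \<sigma> fv "var v"]) (auto simp: \<sigma>_ge_1 fv_var)
next
  fix C :: "('v, 'e) com" and W
  assume "\<forall>v. \<sigma> v * \<sigma> v = \<sigma> v"
  then show "alpha_set \<sigma> (J_set fv C W) = alpha_nat \<sigma> (J_nat fv C W)"
    by (intro alpha_J_eq_if_idem \<sigma>_ge_1) blast
qed (simp_all add: qoi_idem_iff Rep_qoi_nonempty \<sigma>_ge_1)

end
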